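(* Let $\vec\lambda\in\mathbb{C}^n$ and let $\vec{X}=\vec{X}^{(1)}$ be $n$ commuting endomorphisms of a finite-dimensional complex vector space $E=F^{(1)}$. Let $\vec{X}^{(a)}$, $a\in\{2,\ldots,s\}$, be the reduced operators on supplementary spaces $F^{(a)}$, as defined in the context, and let $\bigwedge=\bigwedge_n\langle\vec\eta\rangle$ be the Grassmann algebra with $n$ generators $\vec\eta$. Then any cocycle $C\in E\otimes\bigwedge$ of the Koszul complex $K^*(\vec{X}_\lambda,E)$ is cohomologous to a cocycle $$C_1\in\left(\ker\vec{X}^{(1)}_\lambda\oplus\ker\vec{X}^{(2)}_\lambda\oplus\cdots\oplus\ker\vec{X}^{(s)}_\lambda\right)\otimes\bigwedge.$$
   Context: For commuting operators $\vec{Z}=(Z_1,\ldots,Z_n)$ on a complex vector space $F$ and $\vec\lambda\in\mathbb{C}^n$, write $\vec{Z}_\lambda=(Z_1-\lambda_1\operatorname{id},\ldots,Z_n-\lambda_n\operatorname{id})$ and $\ker\vec{Z}_\lambda=\bigcap_{\ell}\ker(Z_\ell-\lambda_\ell\operatorname{id})$. The Koszul complex $K^*(\vec{Z},F)$ is $0\to F\to F\otimes\bigwedge^1\to\cdots\to F\otimes\bigwedge^n\to0$ with differential $\sum_kZ_k\otimes e_{\eta_k}$, where $e_{\eta_k}$ is left multiplication by $\eta_k$. Reduced operators: start with $F^{(1)}=E$, $\vec{X}^{(1)}=\vec{X}$. For $a\ge2$, choose a subspace $F^{(a)}$ of $F^{(a-1)}$ supplementary to $\ker\vec{X}^{(a-1)}_\lambda$,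 so that $F^{(a-1)}=F^{(a)}\oplus\ker\vec{X}_\lambda^{(a-1)}$, let $i_a:F^{(a)}\to F^{(a-1)}$ be the inclusion and $p_a:F^{(a-1)}\to F^{(a)}$ the projection along $\ker\vec{X}_\lambda^{(a-1)}$, and set $X^{(a)}_\ell=p_aX^{(a-1)}_\ell i_a$, $\ell\in\{1,\ldots,n\}$. (Equivalently, $X_\ell^{(a)}$ is the operator induced by $X_\ell^{(a-1)}$ on the quotient by $\ker\vec{X}_\lambda^{(a-1)}$; the $X^{(a)}_\ell$ are again commuting.) The procedure is iterated until $\ker\vec{X}^{(s+1)}_\lambda=0$ for the first time; this defines $s$. The spaces $\ker\vec{X}^{(a)}_\lambda\subset F^{(a)}\subset E$ are regarded as subspaces of $E$, and their sum is direct. *)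

theory Defs
  imports Complex_Main
begin

text \<open>
  The Grassmann algebra is given by its basis of ordered monomials: an element is the function
  sending a finite set \<open>{i\<^sub>1 < ... < i\<^sub>p}\<close> to the coefficient of
  \<open>\<eta>\<^sub>i\<^sub>1 ... \<eta>\<^sub>i\<^sub>p\<close>. With \<open>n\<close> generators only subsets of
  \<open>{1..n}\<close> carry nonzero coefficients.
\<close>

type_synonym grassmann = "nat set \<Rightarrow> complex"

definition eta_monomial :: "nat set \<Rightarrow> grassmann" where
  "eta_monomial I = (\<lambda>J. if J = I then 1 else 0)"

definition eta :: "nat \<Rightarrow> grassmann" where
  "eta k = eta_monomial {k}"

text \<open>
  Sign of the permutation that sorts the concatenation of the increasing enumerations of two
  disjoint sets.
\<close>

definition shuffle_sign :: "nat set \<Rightarrow> nat set \<Rightarrow> complex" where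
  "shuffle_sign I J = (- 1) ^ card {(i, j). i \<in> I \<and> j \<in> J \<and> j < i}"

definition grassmann_mult :: "grassmann \<Rightarrow> grassmann \<Rightarrow> grassmann" where
  "grassmann_mult x y = (\<lambda>K. \<Sum>I\<in>Pow K. shuffle_sign I (K - I) * x I * y (K - I))"

definition left_mult_eta :: "nat \<Rightarrow> grassmann \<Rightarrow> grassmann" where
  "left_mult_eta k = grassmann_mult (eta k)"

text \<open>
  An element \<open>\<Sum>I. v\<^sub>I \<otimes> \<eta>\<^sub>I\<close> of the tensor product of \<open>F\<close> with the Grassmann
  algebra on \<open>n\<close> generators is represented by its coefficient family \<open>I \<mapsto> v\<^sub>I\<close>.
\<close>

definition tensor_grassmann :: "nat \<Rightarrow> 'e::zero set \<Rightarrow> (nat set \<Rightarrow> 'e) set" where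
  "tensor_grassmann n F =
     {C. (\<forall>I. I \<subseteq> {1..n} \<longrightarrow> C I \<in> F) \<and> (\<forall>I. \<not> I \<subseteq> {1..n} \<longrightarrow> C I = 0)}"

text \<open>
  The operator \<open>Z \<otimes> A\<close>: it sends \<open>v \<otimes> \<eta>\<^sub>I\<close> to \<open>Z v \<otimes> A \<eta>\<^sub>I\<close>.
\<close>

definition tensor_op ::
  "(complex \<Rightarrow> 'e \<Rightarrow> 'e) \<Rightarrow> nat \<Rightarrow> ('e \<Rightarrow> 'e) \<Rightarrow> (grassmann \<Rightarrow> grassmann)
     \<Rightarrow> (nat set \<Rightarrow> 'e::ab_group_add) \<Rightarrow> nat set \<Rightarrow> 'e" where
  "tensor_op scale n Z A C = (\<lambda>J. \<Sum>I\<in>Pow {1..n}. scale (A (eta_monomial I) J) (Z (C I)))"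

definition koszul_d ::
  "(complex \<Rightarrow> 'e \<Rightarrow> 'e) \<Rightarrow> nat \<Rightarrow> (nat \<Rightarrow> 'e \<Rightarrow> 'e)
     \<Rightarrow> (nat set \<Rightarrow> 'e::ab_group_add) \<Rightarrow> nat set \<Rightarrow> 'e" where
  "koszul_d scale n Z C = (\<lambda>J. \<Sum>k=1..n. tensor_op scale n (Z k) (left_mult_eta k) C J)"

text \<open>
  Cochains, cocycles and coboundaries are taken in the total space of the complex and need not
  be homogeneous.
\<close>

definition koszul_cocycle ::
  "(complex \<Rightarrow> 'e \<Rightarrow> 'e) \<Rightarrow> nat \<Rightarrow> (nat \<Rightarrow> 'e \<Rightarrow> 'e) \<Rightarrow> 'e set
     \<Rightarrow> (nat set \<Rightarrow> 'e::ab_group_add) \<Rightarrow> bool" where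
  "koszul_cocycle scale n Z F C \<longleftrightarrow>
     C \<in> tensor_grassmann n F \<and> koszul_d scale n Z C = (\<lambda>J. 0)"

definition koszul_cohomologous ::
  "(complex \<Rightarrow> 'e \<Rightarrow> 'e) \<Rightarrow> nat \<Rightarrow> (nat \<Rightarrow> 'e \<Rightarrow> 'e) \<Rightarrow> 'e set
     \<Rightarrow> (nat set \<Rightarrow> 'e::ab_group_add) \<Rightarrow> (nat set \<Rightarrow> 'e) \<Rightarrow> bool" where
  "koszul_cohomologous scale n Z F C C' \<longleftrightarrow>
     (\<exists>B \<in> tensor_grassmann n F. (\<lambda>J. C J - C' J) = koszul_d scale n Z B)"

definition shifted ::
  "(complex \<Rightarrow> 'e \<Rightarrow> 'e) \<Rightarrow> (nat \<Rightarrow> complex) \<Rightarrow> (nat \<Rightarrow> 'e \<Rightarrow> 'e)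
     \<Rightarrow> nat \<Rightarrow> 'e \<Rightarrow> 'e::ab_group_add" where
  "shifted scale lam Z = (\<lambda>l v. Z l v - scale (lam l) v)"

definition joint_kernel ::
  "nat \<Rightarrow> 'e set \<Rightarrow> (nat \<Rightarrow> 'e \<Rightarrow> 'e) \<Rightarrow> 'e::zero set" where
  "joint_kernel n F Z = {v \<in> F. \<forall>l\<in>{1..n}. Z l v = 0}"

definition supplementary ::
  "(complex \<Rightarrow> 'e \<Rightarrow> 'e) \<Rightarrow> 'e set \<Rightarrow> 'e set \<Rightarrow> 'e::ab_group_add set \<Rightarrow> bool" where
  "supplementary scale V U W \<longleftrightarrow>
     module.subspace scale U \<and> V = {u + w | u w. u \<in> U \<and> w \<in> W} \<and> U \<inter> W = {0}"

text \<open>The projection of \<open>U \<oplus> W\<close> onto \<open>U\<close> along \<open>W\<close>; unspecified outside \<open>U \<oplus> W\<close>.\<close>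

definition projection_along :: "'e set \<Rightarrow> 'e set \<Rightarrow> 'e \<Rightarrow> 'e::ab_group_add" where
  "projection_along U W v = (THE u. u \<in> U \<and> v - u \<in> W)"

text \<open>
  The operators \<open>X\<^sup>(\<^sup>a\<^sup>)\<close> for a given choice \<open>F\<close> of supplementary spaces. They are total
  functions of which only the restriction to \<open>F a\<close> is meaningful, so the inclusions are implicit.
  The numbering starts at 1; the value at 0 is a dummy.
\<close>

fun reduced_ops ::
  "(complex \<Rightarrow> 'e \<Rightarrow> 'e) \<Rightarrow> nat \<Rightarrow> (nat \<Rightarrow> complex) \<Rightarrow> (nat \<Rightarrow> 'e \<Rightarrow> 'e)
     \<Rightarrow> (nat \<Rightarrow> 'e set) \<Rightarrow> nat \<Rightarrow> nat \<Rightarrow> 'e \<Rightarrow> 'e::ab_group_add" where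
  "reduced_ops scale n lam X F 0 = X"
| "reduced_ops scale n lam X F (Suc 0) = X"
| "reduced_ops scale n lam X F (Suc (Suc a)) =
     (\<lambda>l v. projection_along (F (Suc (Suc a)))
        (joint_kernel n (F (Suc a)) (shifted scale lam (reduced_ops scale n lam X F (Suc a))))
        (reduced_ops scale n lam X F (Suc a) l v))"

definition reduced_kernel ::
  "(complex \<Rightarrow> 'e \<Rightarrow> 'e) \<Rightarrow> nat \<Rightarrow> (nat \<Rightarrow> complex) \<Rightarrow> (nat \<Rightarrow> 'e \<Rightarrow> 'e)
     \<Rightarrow> (nat \<Rightarrow> 'e set) \<Rightarrow> nat \<Rightarrow> 'e::ab_group_add set" where
  "reduced_kernel scale n lam X F a =
     joint_kernel n (F a) (shifted scale lam (reduced_ops scale n lam X F a))"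

text \<open>
  \<open>F 1, ..., F (s + 1)\<close> are the spaces of a complete run of the reduction procedure, which stops
  at the first vanishing kernel. The number \<open>s\<close> is 0 if the kernel of the initial operators
  already vanishes.
\<close>

definition reduction_spaces ::
  "(complex \<Rightarrow> 'e \<Rightarrow> 'e) \<Rightarrow> nat \<Rightarrow> (nat \<Rightarrow> complex) \<Rightarrow> (nat \<Rightarrow> 'e \<Rightarrow> 'e)
     \<Rightarrow> (nat \<Rightarrow> 'e::ab_group_add set) \<Rightarrow> nat \<Rightarrow> bool" where
  "reduction_spaces scale n lam X F s \<longleftrightarrow>
     F 1 = UNIV \<and>
     (\<forall>a\<in>{2..s+1}. supplementary scale (F (a - 1)) (F a) (reduced_kernel scale n lam X F (a - 1))) \<and>
     (\<forall>a\<in>{1..s}. reduced_kernel scale n lam X F a \<noteq> {0}) \<and>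
     reduced_kernel scale n lam X F (s + 1) = {0}"

definition sum_of_subspaces :: "nat \<Rightarrow> (nat \<Rightarrow> 'e set) \<Rightarrow> 'e::comm_monoid_add set" where
  "sum_of_subspaces s K = {\<Sum>a=1..s. v a | v. \<forall>a\<in>{1..s}. v a \<in> K a}"

end

theory Submission
  imports Defs
begin

text \<open>
  Put \<open>Z = X - \<lambda>\<close> and let \<open>G\<close> be the sum of the reduced kernels. Operators \<open>Y\<^sub>k\<close> commuting with
  all \<open>Z\<^sub>l\<close> give a map \<open>h = \<Sum>k. Y\<^sub>k \<otimes> \<partial>/\<partial>\<eta>\<^sub>k\<close> with \<open>d h + h d = \<Sum>k. Z\<^sub>k Y\<^sub>k\<close>, so a cocycle \<open>C\<close> is
  cohomologous to \<open>P C\<close>, where \<open>P = 1 - \<Sum>k. Z\<^sub>k Y\<^sub>k\<close>. By finite-dimensionality the \<open>Y\<^sub>k\<close> can be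
  chosen such that every coefficient of \<open>P C\<close> is annihilated by a power of each \<open>Z\<^sub>k\<close>. Such vectors
  lie in \<open>G\<close>, because the reduction only stops when \<open>Z\<^sub>k v \<in> G\<close> for all \<open>k\<close> forces \<open>v \<in> G\<close>.
\<close>

section \<open>The Koszul differential in coordinates\<close>

text \<open>The sign picked up when eta_k moves past the smaller generators of a monomial. Since
  \<open>k\<close> itself is not counted, the same sign serves multiplication by eta_k
  (\<open>k\<close> in \<open>J\<close>) and contraction (\<open>k\<close> not in
  \<open>J\<close>).\<close>

definition koszul_sign :: "nat \<Rightarrow> nat set \<Rightarrow> complex" where
  "koszul_sign k J = (- 1) ^ card {j \<in> J. j < k}"

lemma koszul_sign_square: "koszul_sign k J * koszul_sign k J = 1"
  unfolding koszul_sign_def by (metis left_minus_one_mult_self mult.right_neutral)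

lemma koszul_sign_remove_self: "koszul_sign k (J - {k}) = koszul_sign k J"
  unfolding koszul_sign_def by (rule arg_cong[where f = "\<lambda>S. (- 1) ^ card S"]) auto

lemma koszul_sign_insert_self: "koszul_sign k (insert k J) = koszul_sign k J"
  unfolding koszul_sign_def by (rule arg_cong[where f = "\<lambda>S. (- 1) ^ card S"]) auto

lemma koszul_sign_insert:
  assumes "finite J" "k \<notin> J"
  shows "koszul_sign l (insert k J) = (if k < l then - koszul_sign l J else koszul_sign l J)"
proof -
  have "{j \<in> insert k J. j < l} = (if k < l then insert k {j \<in> J. j < l} else {j \<in> J. j < l})"
    by auto
  then show ?thesis
    using assms by (simp add: koszul_sign_def)
qed

text \<open>Multiplication by eta_l and contraction by eta_k anticommute for distinct indices:
  exactly one of \<open>l < k\<close> and \<open>k < l\<close> holds, so exactly one of the two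
  factors changes sign.\<close>

lemma koszul_sign_exchange:
  assumes "finite J" "l \<in> J" "k \<notin> J"
  shows "koszul_sign k J * koszul_sign l (insert k J) = - (koszul_sign l J * koszul_sign k (J - {l}))"
proof -
  have "koszul_sign k J = (if l < k then - koszul_sign k (J - {l}) else koszul_sign k (J - {l}))"
    using koszul_sign_insert[of "J - {l}" l k] assms by (simp add: insert_absorb)
  moreover have "l \<noteq> k"
    using assms by auto
  ultimately show ?thesis
    using koszul_sign_insert[of J k l] assms by (simp add: not_less_iff_gr_or_eq)
qed

lemma left_mult_eta_monomial:
  assumes "finite I"
  shows "left_mult_eta k (eta_monomial I) J = (if k \<in> J \<and> I = J - {k} then koszul_sign k J else 0)"
proof (cases "finite J")
  case True
  have sign: "shuffle_sign {k} (J - {k}) = koszul_sign k J"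
  proof -
    have "{(i, j). i \<in> {k} \<and> j \<in> J - {k} \<and> j < i} = Pair k ` {j \<in> J. j < k}"
      by auto
    then show ?thesis
      by (simp add: shuffle_sign_def koszul_sign_def card_image inj_on_def)
  qed
  have "left_mult_eta k (eta_monomial I) J
      = (\<Sum>L\<in>Pow J. if L = {k} then shuffle_sign L (J - L) * eta_monomial I (J - L) else 0)"
    unfolding left_mult_eta_def grassmann_mult_def eta_def
    by (rule sum.cong) (auto simp: eta_monomial_def)
  also have "\<dots> = (if {k} \<in> Pow J then shuffle_sign {k} (J - {k}) * eta_monomial I (J - {k}) else 0)"
    using True by (subst sum.delta) auto
  also have "\<dots> = (if k \<in> J \<and> I = J - {k} then koszul_sign k J else 0)"
    unfolding sign by (auto simp: eta_monomial_def)
  finally show ?thesis .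
next
  \<comment> \<open>The sum over the infinite set \<open>Pow J\<close> is 0 by default, and a finite
    \<open>I\<close> cannot equal \<open>J - {k}\<close>, so both sides vanish.\<close>
  case False
  then have "I \<noteq> J - {k}"
    using assms by auto
  then show ?thesis
    using False by (simp add: left_mult_eta_def grassmann_mult_def)
qed

section \<open>Linear operators and the differential of a commuting family\<close>

context vector_space
begin

lemma linear_diff_op:
  assumes "Vector_Spaces.linear scale scale f" "Vector_Spaces.linear scale scale g"
  shows "Vector_Spaces.linear scale scale (\<lambda>v. f v - g v)"
  using assms by (simp add: Vector_Spaces.linear_iff vector_space_axioms scale_right_diff_distrib)

lemma linear_add_op:
  assumes "Vector_Spaces.linear scale scale f" "Vector_Spaces.linear scale scale g"
  shows "Vector_Spaces.linear scale scale (\<lambda>v. f v + g v)"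
  using assms by (simp add: Vector_Spaces.linear_iff vector_space_axioms scale_right_distrib)

lemma linear_compose_op:
  assumes "Vector_Spaces.linear scale scale f" "Vector_Spaces.linear scale scale g"
  shows "Vector_Spaces.linear scale scale (\<lambda>v. f (g v))"
  using assms by (simp add: Vector_Spaces.linear_iff vector_space_axioms)

end

text \<open>The order matters: \<open>linear_op_simps(5)\<close> is cited below for preservation of
  zero.\<close>

lemmas linear_op_simps =
  module_hom.add[OF Vector_Spaces.linear.axioms(3)]
  module_hom.diff[OF Vector_Spaces.linear.axioms(3)]
  module_hom.scale[OF Vector_Spaces.linear.axioms(3)]
  module_hom.sum[OF Vector_Spaces.linear.axioms(3)]
  module_hom.zero[OF Vector_Spaces.linear.axioms(3)]

locale commuting_operators = vector_space scale
  for scale :: "complex \<Rightarrow> 'e::ab_group_add \<Rightarrow> 'e" (infixr "*s" 75) +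
  fixes n :: nat and Z :: "nat \<Rightarrow> 'e \<Rightarrow> 'e"
  assumes linear_Z: "k \<in> {1..n} \<Longrightarrow> Vector_Spaces.linear scale scale (Z k)"
    and Z_commute: "k \<in> {1..n} \<Longrightarrow> l \<in> {1..n} \<Longrightarrow> Z k (Z l v) = Z l (Z k v)"
begin

text \<open>Multiplication by eta_k reaches the monomial of \<open>J\<close> only from that of
  \<open>J - {k}\<close>, so for each \<open>k\<close> the sum over \<open>I\<close> collapses to at
  most one term.\<close>

lemma koszul_d_eq:
  "koszul_d scale n Z C J =
     (if J \<subseteq> {1..n} then \<Sum>k\<in>J. koszul_sign k J *s Z k (C (J - {k})) else 0)"
proof -
  have summand: "tensor_op scale n (Z k) (left_mult_eta k) C J =
      (if k \<in> J \<and> J \<subseteq> {1..n} then koszul_sign k J *s Z k (C (J - {k})) else 0)"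
    if k: "k \<in> {1..n}" for k
  proof -
    have "tensor_op scale n (Z k) (left_mult_eta k) C J =
        (\<Sum>I\<in>Pow {1..n}. if I = J - {k} then (if k \<in> J then koszul_sign k J *s Z k (C I) else 0) else 0)"
      unfolding tensor_op_def
      by (rule sum.cong) (auto simp: left_mult_eta_monomial finite_subset)
    also have "\<dots> = (if J - {k} \<in> Pow {1..n}
        then (if k \<in> J then koszul_sign k J *s Z k (C (J - {k})) else 0) else 0)"
      by (subst sum.delta) auto
    finally show ?thesis
      using k by auto
  qed
  have "koszul_d scale n Z C J =
      (\<Sum>k=1..n. if k \<in> J \<and> J \<subseteq> {1..n} then koszul_sign k J *s Z k (C (J - {k})) else 0)"
    unfolding koszul_d_def by (rule sum.cong) (use summand in auto)
  also have "\<dots> = (if J \<subseteq> {1..n} then \<Sum>k\<in>J. koszul_sign k J *s Z k (C (J - {k})) else 0)"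
  proof (cases "J \<subseteq> {1..n}")
    case True
    then have "{1..n} \<inter> J = J"
      by auto
    then show ?thesis
      using True sum.inter_restrict[of "{1..n}" "\<lambda>k. koszul_sign k J *s Z k (C (J - {k}))" J] by simp
  qed auto
  finally show ?thesis .
qed

section \<open>The commutant and the homotopy\<close>

text \<open>The algebra from which the Y_k of the homotopy are drawn. Its elements commute with
  every Z_k but may fail to commute with one another.\<close>

definition commutant :: "('e \<Rightarrow> 'e) set" where
  "commutant = {A. Vector_Spaces.linear scale scale A \<and> (\<forall>k\<in>{1..n}. \<forall>v. A (Z k v) = Z k (A v))}"

lemma commutant_linear: "A \<in> commutant \<Longrightarrow> Vector_Spaces.linear scale scale A"
  by (simp add: commutant_def)

lemma commutant_commute: "A \<in> commutant \<Longrightarrow> k \<in> {1..n} \<Longrightarrow> A (Z k v) = Z k (A v)"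
  by (simp add: commutant_def)

lemma commutant_Z: "k \<in> {1..n} \<Longrightarrow> Z k \<in> commutant"
  using linear_Z Z_commute by (auto simp: commutant_def)

lemma commutant_id: "(\<lambda>v. v) \<in> commutant"
  using linear_id by (simp add: commutant_def id_def)

lemma commutant_zero: "(\<lambda>v. 0) \<in> commutant"
  by (auto simp: commutant_def Vector_Spaces.linear_iff vector_space_axioms linear_op_simps[OF linear_Z])

lemma commutant_add: "A \<in> commutant \<Longrightarrow> B \<in> commutant \<Longrightarrow> (\<lambda>v. A v + B v) \<in> commutant"
  by (auto simp: commutant_def linear_add_op linear_op_simps[OF linear_Z])

lemma commutant_diff: "A \<in> commutant \<Longrightarrow> B \<in> commutant \<Longrightarrow> (\<lambda>v. A v - B v) \<in> commutant"
  by (auto simp: commutant_def linear_diff_op linear_op_simps[OF linear_Z])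

lemma commutant_scale: "A \<in> commutant \<Longrightarrow> (\<lambda>v. c *s A v) \<in> commutant"
  by (auto simp: commutant_def Vector_Spaces.linear_iff vector_space_axioms linear_op_simps[OF linear_Z]
      scale_right_distrib mult.commute)

lemma commutant_compose: "A \<in> commutant \<Longrightarrow> B \<in> commutant \<Longrightarrow> (\<lambda>v. A (B v)) \<in> commutant"
  by (auto simp: commutant_def linear_compose_op)

lemma commutant_sum:
  "(\<And>i. i \<in> S \<Longrightarrow> A i \<in> commutant) \<Longrightarrow> (\<lambda>v. \<Sum>i\<in>S. A i v) \<in> commutant"
  by (induction S rule: infinite_finite_induct) (auto simp: commutant_zero commutant_add)

lemma commutant_complement:
  assumes "\<And>k. k \<in> {1..n} \<Longrightarrow> Y k \<in> commutant"
  shows "(\<lambda>v. v - (\<Sum>k=1..n. Z k (Y k v))) \<in> commutant"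
  by (rule commutant_diff[OF commutant_id commutant_sum], rule commutant_compose[OF commutant_Z])
    (use assms in auto)

lemma commutant_funpow: "k \<in> {1..n} \<Longrightarrow> Z k ^^ N \<in> commutant"
proof (induction N)
  case (Suc N)
  then show ?case
    using commutant_compose[OF commutant_Z, of k "Z k ^^ N"] by (simp add: comp_def)
qed (simp add: commutant_id id_def)

lemma funpow_commute:
  "A \<in> commutant \<Longrightarrow> k \<in> {1..n} \<Longrightarrow> (Z k ^^ N) (A v) = A ((Z k ^^ N) v)"
  by (induction N) (auto simp: commutant_commute)

lemma funpow_Z_zero: "k \<in> {1..n} \<Longrightarrow> (Z k ^^ N) 0 = 0"
  using linear_op_simps(5)[OF commutant_linear[OF commutant_funpow]] .

text \<open>This is the map \<open>h\<close>: the coefficient at \<open>J\<close> comes from the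
  monomials with one more generator. The value 0 outside the subsets of \<open>{1..n}\<close> keeps
  the result in \<open>tensor_grassmann n UNIV\<close>.\<close>

definition contraction :: "(nat \<Rightarrow> 'e \<Rightarrow> 'e) \<Rightarrow> (nat set \<Rightarrow> 'e) \<Rightarrow> nat set \<Rightarrow> 'e" where
  "contraction Y C J =
     (if J \<subseteq> {1..n} then \<Sum>k\<in>{1..n} - J. koszul_sign k J *s Y k (C (insert k J)) else 0)"

text \<open>Terms that remove and insert the same index \<open>k\<close> give Z_k Y_k, from
  \<open>d h\<close> if \<open>k\<close> is in \<open>J\<close> and from \<open>h d\<close>
  otherwise. Terms with two different indices cancel by \<open>koszul_sign_exchange\<close>.\<close>

lemma contraction_homotopy:
  assumes Y: "\<And>k. k \<in> {1..n} \<Longrightarrow> Y k \<in> commutant"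
    and J: "J \<subseteq> {1..n}"
  shows "koszul_d scale n Z (contraction Y C) J + contraction Y (koszul_d scale n Z C) J
    = (\<Sum>k=1..n. Z k (Y k (C J)))"
proof -
  note linY = linear_op_simps[OF commutant_linear[OF Y]]
  note linZ = linear_op_simps[OF linear_Z]
  have fin: "finite J"
    using J finite_subset by blast
  \<comment> \<open>The mixed term in which \<open>l\<close> in \<open>J\<close> is exchanged for
    \<open>k\<close> outside \<open>J\<close>. It enters \<open>d h\<close> with a plus sign and
    \<open>h d\<close> with a minus sign.\<close>
  let ?m = "\<lambda>l k. (koszul_sign l J * koszul_sign k (J - {l})) *s Z l (Y k (C (insert k (J - {l}))))"
  have dh: "koszul_d scale n Z (contraction Y C) J
      = (\<Sum>l\<in>J. Z l (Y l (C J))) + (\<Sum>l\<in>J. \<Sum>k\<in>{1..n} - J. ?m l k)"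
  proof -
    have "koszul_sign l J *s Z l (contraction Y C (J - {l}))
        = Z l (Y l (C J)) + (\<Sum>k\<in>{1..n} - J. ?m l k)" if l: "l \<in> J" for l
    proof -
      have ln: "l \<in> {1..n}"
        using l J by auto
      have split: "{1..n} - (J - {l}) = insert l ({1..n} - J)"
        using ln by auto
      have "contraction Y C (J - {l})
          = (\<Sum>k\<in>{1..n} - (J - {l}). koszul_sign k (J - {l}) *s Y k (C (insert k (J - {l}))))"
        using J unfolding contraction_def by auto
      also have "\<dots> = koszul_sign l J *s Y l (C J)
          + (\<Sum>k\<in>{1..n} - J. koszul_sign k (J - {l}) *s Y k (C (insert k (J - {l}))))"
        unfolding split using l by (simp add: koszul_sign_remove_self insert_absorb)
      finally show ?thesis
        using ln by (simp add: linZ scale_right_distrib scale_sum_right koszul_sign_square)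
    qed
    then show ?thesis
      using J by (simp add: koszul_d_eq sum.distrib)
  qed
  have hd: "contraction Y (koszul_d scale n Z C) J
      = (\<Sum>k\<in>{1..n} - J. Z k (Y k (C J))) - (\<Sum>k\<in>{1..n} - J. \<Sum>l\<in>J. ?m l k)"
  proof -
    have "koszul_sign k J *s Y k (koszul_d scale n Z C (insert k J))
        = Z k (Y k (C J)) - (\<Sum>l\<in>J. ?m l k)" if k: "k \<in> {1..n} - J" for k
    proof -
      have kn: "k \<in> {1..n}" "k \<notin> J"
        using k by auto
      have "koszul_d scale n Z C (insert k J)
          = koszul_sign k J *s Z k (C J)
            + (\<Sum>l\<in>J. koszul_sign l (insert k J) *s Z l (C (insert k J - {l})))"
        using kn J fin by (simp add: koszul_d_eq koszul_sign_insert_self)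
      then have "koszul_sign k J *s Y k (koszul_d scale n Z C (insert k J))
          = Z k (Y k (C J))
            + (\<Sum>l\<in>J. (koszul_sign k J * koszul_sign l (insert k J)) *s Y k (Z l (C (insert k J - {l}))))"
        using kn by (simp add: linY scale_right_distrib scale_sum_right koszul_sign_square
            commutant_commute[OF Y])
      also have "(\<Sum>l\<in>J. (koszul_sign k J * koszul_sign l (insert k J)) *s Y k (Z l (C (insert k J - {l}))))
          = (\<Sum>l\<in>J. - ?m l k)"
      proof (rule sum.cong)
        fix l assume l: "l \<in> J"
        then have "insert k J - {l} = insert k (J - {l})" "l \<in> {1..n}"
          using kn J by auto
        then show "(koszul_sign k J * koszul_sign l (insert k J)) *s Y k (Z l (C (insert k J - {l})))
            = - ?m l k"
          using koszul_sign_exchange[OF fin l kn(2)] commutant_commute[OF Y] kn by simp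
      qed simp
      finally show ?thesis
        by (simp add: sum_negf)
    qed
    then show ?thesis
      using J by (simp add: contraction_def sum_subtractf)
  qed
  have "(\<Sum>k\<in>{1..n} - J. \<Sum>l\<in>J. ?m l k) = (\<Sum>l\<in>J. \<Sum>k\<in>{1..n} - J. ?m l k)"
    by (rule sum.swap)
  moreover have "(\<Sum>k=1..n. Z k (Y k (C J)))
      = (\<Sum>k\<in>{1..n} - J. Z k (Y k (C J))) + (\<Sum>k\<in>J. Z k (Y k (C J)))"
    using J by (intro sum.subset_diff) auto
  ultimately show ?thesis
    using dh hd by simp
qed

text \<open>This makes \<open>P\<close> a chain map, so that \<open>P C\<close> is again a
  cocycle.\<close>

lemma koszul_d_compose_commutant:
  assumes P: "P \<in> commutant"
  shows "koszul_d scale n Z (\<lambda>J. P (C J)) J = P (koszul_d scale n Z C J)"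
proof -
  note linP = linear_op_simps[OF commutant_linear[OF P]]
  have "(\<Sum>k\<in>J. koszul_sign k J *s Z k (P (C (J - {k}))))
      = (\<Sum>k\<in>J. koszul_sign k J *s P (Z k (C (J - {k}))))" if "J \<subseteq> {1..n}"
    using that by (intro sum.cong) (auto simp: commutant_commute[OF P])
  then show ?thesis
    by (simp add: koszul_d_eq linP)
qed

text \<open>On a cocycle the term \<open>h d C\<close> drops out of the homotopy identity, leaving
  \<open>C - P C = d (h C)\<close>; the bounding cochain is \<open>contraction Y C\<close>.\<close>

lemma cocycle_cohomologous_complement:
  assumes Y: "\<And>k. k \<in> {1..n} \<Longrightarrow> Y k \<in> commutant"
    and C: "koszul_cocycle scale n Z UNIV C"
  defines "P \<equiv> \<lambda>v. v - (\<Sum>k=1..n. Z k (Y k v))"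
  shows "koszul_cocycle scale n Z UNIV (\<lambda>J. P (C J))"
    and "koszul_cohomologous scale n Z UNIV C (\<lambda>J. P (C J))"
proof -
  have P: "P \<in> commutant"
    unfolding P_def by (rule commutant_complement[OF Y])
  have P0: "P 0 = 0"
    by (rule linear_op_simps(5)[OF commutant_linear[OF P]])
  have C0: "C J = 0" if "\<not> J \<subseteq> {1..n}" for J
    using C that by (auto simp: koszul_cocycle_def tensor_grassmann_def)
  have dC: "koszul_d scale n Z C = (\<lambda>J. 0)"
    using C by (simp add: koszul_cocycle_def)
  show "koszul_cocycle scale n Z UNIV (\<lambda>J. P (C J))"
    using C0 by (auto simp: koszul_cocycle_def tensor_grassmann_def koszul_d_compose_commutant[OF P]
        dC P0)
  have "C J - P (C J) = koszul_d scale n Z (contraction Y C) J" for J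
  proof (cases "J \<subseteq> {1..n}")
    case True
    have "contraction Y (koszul_d scale n Z C) J = 0"
      unfolding dC contraction_def using linear_op_simps(5)[OF commutant_linear[OF Y]] by simp
    then show ?thesis
      using contraction_homotopy[where Y = Y and C = C, OF Y True] by (simp add: P_def)
  next
    case False
    then show ?thesis
      by (simp add: koszul_d_eq C0 P0)
  qed
  moreover have "contraction Y C \<in> tensor_grassmann n UNIV"
    by (simp add: tensor_grassmann_def contraction_def)
  ultimately show "koszul_cohomologous scale n Z UNIV C (\<lambda>J. P (C J))"
    by (auto simp: koszul_cohomologous_def)
qed

text \<open>Induction on the sum of the annihilating exponents. Applying Z_j lowers the exponent of
  index \<open>j\<close> and, by commutation, leaves the others valid, so every Z_j \<open>v\<close>
  is in \<open>G\<close> by induction and \<open>closed\<close> brings \<open>v\<close> back into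
  \<open>G\<close>. An exponent 0 means \<open>v = 0\<close>.\<close>

lemma jointly_nilpotent_in:
  assumes zero: "0 \<in> G"
    and closed: "\<And>v. (\<And>k. k \<in> {1..n} \<Longrightarrow> Z k v \<in> G) \<Longrightarrow> v \<in> G"
    and nil: "\<And>k. k \<in> {1..n} \<Longrightarrow> \<exists>N. (Z k ^^ N) v = 0"
  shows "v \<in> G"
proof -
  obtain f where "\<forall>k\<in>{1..n}. (Z k ^^ f k) v = 0"
    using nil by metis
  then show ?thesis
  proof (induction "\<Sum>k=1..n. f k" arbitrary: f v rule: less_induct)
    case less
    show ?case
    proof (cases "\<exists>k\<in>{1..n}. f k = 0")
      case True
      then show ?thesis
        using less.prems zero by (metis funpow_0)
    next
      case False
      show ?thesis
      proof (rule closed)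
        fix j assume j: "j \<in> {1..n}"
        let ?f = "f(j := f j - 1)"
        have "(\<Sum>k=1..n. ?f k) < (\<Sum>k=1..n. f k)"
          using j False by (intro sum_strict_mono_ex1) auto
        moreover have "(Z k ^^ ?f k) (Z j v) = 0" if k: "k \<in> {1..n}" for k
        proof (cases "k = j")
          case True
          have "(Z j ^^ Suc (f j - 1)) v = 0"
            using less.prems False j by auto
          then show ?thesis
            using True by (simp add: funpow_swap1)
        next
          case False
          then show ?thesis
            using less.prems k funpow_commute[OF commutant_Z[OF j], of k "f k" v]
            by (simp add: linear_op_simps(5)[OF linear_Z[OF j]])
        qed
        ultimately show "Z j v \<in> G"
          using less.hyps by blast
      qed
    qed
  qed
qed

end

section \<open>Choosing the Y_k in finite dimension\<close>

locale finite_dimensional_commuting_operators =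
  commuting_operators scale n Z + finite_dimensional_vector_space scale Basis
  for scale :: "complex \<Rightarrow> 'e::ab_group_add \<Rightarrow> 'e" (infixr "*s" 75) and n Z Basis
begin

text \<open>A Fitting-type argument on the orbit of \<open>v\<close> under the commutant: its images
  under the powers of \<open>Z k\<close> form a descending chain of subspaces, which becomes
  stationary. The operator \<open>A\<close> may depend on \<open>v\<close>.\<close>

lemma ex_commutant_annihilating:
  assumes k: "k \<in> {1..n}"
  shows "\<exists>N. \<exists>A\<in>commutant. (Z k ^^ N) (v - Z k (A v)) = 0"
proof -
  define M where "M N = {(Z k ^^ N) (A v) | A. A \<in> commutant}" for N
  note lin = linear_op_simps[OF commutant_linear[OF commutant_funpow[OF k]]]
  have sub: "subspace (M N)" for N
  proof (rule subspaceI)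
    show "0 \<in> M N"
      unfolding M_def using commutant_zero funpow_Z_zero[OF k] by force
  next
    fix x y assume "x \<in> M N" "y \<in> M N"
    then obtain A B where "A \<in> commutant" "B \<in> commutant"
      "x = (Z k ^^ N) (A v)" "y = (Z k ^^ N) (B v)"
      unfolding M_def by auto
    then show "x + y \<in> M N"
      unfolding M_def by (auto intro!: exI[of _ "\<lambda>v. A v + B v"] simp: lin commutant_add)
  next
    fix c x assume "x \<in> M N"
    then obtain A where "A \<in> commutant" "x = (Z k ^^ N) (A v)"
      unfolding M_def by auto
    then show "c *s x \<in> M N"
      unfolding M_def by (auto intro!: exI[of _ "\<lambda>v. c *s A v"] simp: lin commutant_scale)
  qed
  have mono: "M (Suc N) \<subseteq> M N" for N
  proof
    fix x assume "x \<in> M (Suc N)"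
    then obtain A where "A \<in> commutant" "x = (Z k ^^ Suc N) (A v)"
      unfolding M_def by blast
    then show "x \<in> M N"
      unfolding M_def using commutant_compose[OF commutant_Z[OF k], of A]
      by (auto simp: funpow_swap1 intro!: exI[of _ "\<lambda>v. Z k (A v)"])
  qed
  \<comment> \<open>A stage of least dimension is already stationary, because
    \<open>M (Suc N)\<close> lies in \<open>M N\<close> and cannot have smaller dimension.\<close>
  obtain N where N: "\<And>N'. dim (M N) \<le> dim (M N')"
    using ex_has_least_nat[of "\<lambda>_. True" 0 "\<lambda>N. dim (M N)"] by auto
  have "M (Suc N) = M N"
    using subspace_dim_equal[OF sub sub mono N] .
  \<comment> \<open>The identity belongs to the commutant. Stationarity then writes this vector as
    the image under the next power of some \<open>A v\<close>.\<close>
  moreover have "(Z k ^^ N) v \<in> M N"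
    unfolding M_def using commutant_id by auto
  ultimately obtain A where A: "A \<in> commutant" "(Z k ^^ N) v = (Z k ^^ Suc N) (A v)"
    unfolding M_def by blast
  then have "(Z k ^^ N) (v - Z k (A v)) = 0"
    by (simp add: lin funpow_swap1)
  then show ?thesis
    using A by blast
qed

text \<open>The pairs are treated one at a time: \<open>P\<close> is replaced by
  \<open>(1 - Z_k A) P\<close>, where \<open>A\<close> serves the new pair. The added factor
  commutes with all Z_j, so the pairs already treated stay annihilated.\<close>

lemma ex_complement_nilpotent:
  assumes "finite S" "S \<subseteq> {1..n} \<times> UNIV"
  shows "\<exists>Y. (\<forall>k\<in>{1..n}. Y k \<in> commutant) \<and>
    (\<forall>k v. (k, v) \<in> S \<longrightarrow> (\<exists>N. (Z k ^^ N) (v - (\<Sum>l=1..n. Z l (Y l v))) = 0))"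
  using assms
proof (induction S rule: finite_induct)
  case empty
  show ?case
    using commutant_zero by (intro exI[of _ "\<lambda>_ _. 0"]) auto
next
  case (insert p S)
  obtain k w where p: "p = (k, w)" and k: "k \<in> {1..n}"
    using insert.prems by auto
  have "S \<subseteq> {1..n} \<times> UNIV"
    using insert.prems by auto
  from insert.IH[OF this] obtain Y where "\<forall>l\<in>{1..n}. Y l \<in> commutant"
    and nil: "\<forall>j v. (j, v) \<in> S \<longrightarrow> (\<exists>N. (Z j ^^ N) (v - (\<Sum>l=1..n. Z l (Y l v))) = 0)"
    by blast
  then have Y: "Y l \<in> commutant" if "l \<in> {1..n}" for l
    using that by blast
  define P where "P v = v - (\<Sum>l=1..n. Z l (Y l v))" for v
  have P: "P \<in> commutant"
    unfolding P_def by (rule commutant_complement[OF Y])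
  \<comment> \<open>Applying the lemma to \<open>P w\<close> instead of \<open>w\<close> avoids having to know that \<open>A\<close> and \<open>P\<close> commute.\<close>
  obtain N A where A: "A \<in> commutant" "(Z k ^^ N) (P w - Z k (A (P w))) = 0"
    using ex_commutant_annihilating[OF k] by blast
  \<comment> \<open>Expanding \<open>(1 - Z_k A) P\<close> gives \<open>P - Z_k A P\<close>, so only
    Y_k has to change, by the summand \<open>A P\<close>.\<close>
  define Y' where "Y' = Y(k := \<lambda>v. Y k v + A (P v))"
  have Y': "Y' l \<in> commutant" if "l \<in> {1..n}" for l
    using that Y A(1) P by (simp add: Y'_def commutant_add commutant_compose)
  have Y'_sum: "v - (\<Sum>l=1..n. Z l (Y' l v)) = P v - Z k (A (P v))" for v
  proof -
    have "(\<Sum>l=1..n. Z l (Y' l v)) = (\<Sum>l=1..n. Z l (Y l v) + (if l = k then Z k (A (P v)) else 0))"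
      by (rule sum.cong) (auto simp: Y'_def linear_op_simps[OF linear_Z] k)
    also have "\<dots> = (\<Sum>l=1..n. Z l (Y l v)) + Z k (A (P v))"
      using k by (simp add: sum.distrib)
    finally show ?thesis
      by (simp add: P_def)
  qed
  have "\<exists>N. (Z j ^^ N) (P v - Z k (A (P v))) = 0" if jv: "(j, v) \<in> S" for j v
  proof -
    have j: "j \<in> {1..n}"
      using jv insert.prems by auto
    obtain N where "(Z j ^^ N) (P v) = 0"
      using nil jv unfolding P_def by blast
    moreover have "(\<lambda>x. x - Z k (A x)) \<in> commutant"
      by (rule commutant_diff[OF commutant_id commutant_compose[OF commutant_Z[OF k] A(1)]])
    ultimately have "(Z j ^^ N) (P v - Z k (A (P v))) = 0"
      using funpow_commute[of "\<lambda>x. x - Z k (A x)" j N "P v"] j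
        linear_op_simps(5)[OF linear_Z[OF k]] linear_op_simps(5)[OF commutant_linear[OF A(1)]]
      by simp
    then show ?thesis ..
  qed
  then have "\<forall>j v. (j, v) \<in> insert p S \<longrightarrow> (\<exists>N. (Z j ^^ N) (v - (\<Sum>l=1..n. Z l (Y' l v))) = 0)"
    unfolding Y'_sum p using A(2) by auto
  then show ?case
    using Y' by blast
qed

text \<open>Only \<open>zero\<close> and \<open>closed\<close> tie \<open>G\<close> to the
  operators; the reduction procedure later supplies a \<open>G\<close> with these
  properties.\<close>

lemma cocycle_cohomologous_in:
  assumes zero: "0 \<in> G"
    and closed: "\<And>v. (\<And>k. k \<in> {1..n} \<Longrightarrow> Z k v \<in> G) \<Longrightarrow> v \<in> G"
    and C: "koszul_cocycle scale n Z UNIV C"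
  shows "\<exists>C'. koszul_cocycle scale n Z UNIV C' \<and> koszul_cohomologous scale n Z UNIV C C'
    \<and> C' \<in> tensor_grassmann n G"
proof -
  \<comment> \<open>A cochain has finitely many coefficients, so one choice of the Y_k can serve
    every index and every coefficient at once.\<close>
  let ?S = "{1..n} \<times> C ` Pow {1..n}"
  have "finite ?S" "?S \<subseteq> {1..n} \<times> UNIV"
    by auto
  from ex_complement_nilpotent[OF this] obtain Y where "\<forall>k\<in>{1..n}. Y k \<in> commutant"
    and nil: "\<forall>k v. (k, v) \<in> ?S \<longrightarrow> (\<exists>N. (Z k ^^ N) (v - (\<Sum>l=1..n. Z l (Y l v))) = 0)"
    by blast
  then have Y: "Y k \<in> commutant" if "k \<in> {1..n}" for k
    using that by blast
  let ?C = "\<lambda>J. C J - (\<Sum>l=1..n. Z l (Y l (C J)))"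
  have cocycle: "koszul_cocycle scale n Z UNIV ?C" and "koszul_cohomologous scale n Z UNIV C ?C"
    using cocycle_cohomologous_complement[OF Y C] by auto
  moreover have "?C J \<in> G" if "J \<subseteq> {1..n}" for J
  proof (rule jointly_nilpotent_in)
    show "0 \<in> G"
      by (rule zero)
    show "v \<in> G" if "\<And>k. k \<in> {1..n} \<Longrightarrow> Z k v \<in> G" for v
      using that by (rule closed)
    show "\<exists>N. (Z k ^^ N) (?C J) = 0" if "k \<in> {1..n}" for k
      using nil that \<open>J \<subseteq> {1..n}\<close> by blast
  qed
  then have "?C \<in> tensor_grassmann n G"
    using cocycle by (simp add: koszul_cocycle_def tensor_grassmann_def)
  ultimately show ?thesis
    by blast
qed

end

section \<open>The reduction procedure\<close>

text \<open>Two candidates for the projection differ by an element of the intersection of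
  \<open>U\<close> and \<open>W\<close>. Closure under differences is the form in which
  \<open>kernel_diff\<close> will supply the condition on \<open>W\<close>.\<close>

lemma projection_along_props:
  assumes U: "\<And>x y. x \<in> U \<Longrightarrow> y \<in> U \<Longrightarrow> x - y \<in> U"
    and W: "\<And>x y. x \<in> W \<Longrightarrow> y \<in> W \<Longrightarrow> x - y \<in> W"
    and UW: "U \<inter> W = {0}"
    and u: "u \<in> U" "v - u \<in> W"
  shows "projection_along U W v = u"
  unfolding projection_along_def
proof (rule the_equality)
  fix u' assume u': "u' \<in> U \<and> v - u' \<in> W"
  then have "u' - u \<in> U" "u' - u \<in> W"
    using U[of u' u] W[of "v - u" "v - u'"] u by auto
  then have "u' - u \<in> {0}"
    using UW by blast
  then show "u' = u"
    by simp
qed (use u in simp)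

locale reduction = vector_space scale
  for scale :: "complex \<Rightarrow> 'e::ab_group_add \<Rightarrow> 'e" (infixr "*s" 75) +
  fixes n s :: nat and lam :: "nat \<Rightarrow> complex" and X :: "nat \<Rightarrow> 'e \<Rightarrow> 'e" and F :: "nat \<Rightarrow> 'e set"
  assumes additive_X: "l \<in> {1..n} \<Longrightarrow> X l (u + v) = X l u + X l v"
    and spaces: "reduction_spaces scale n lam X F s"
begin

abbreviation R :: "nat \<Rightarrow> nat \<Rightarrow> 'e \<Rightarrow> 'e" where
  "R \<equiv> reduced_ops scale n lam X F"

abbreviation K :: "nat \<Rightarrow> 'e set" where
  "K \<equiv> reduced_kernel scale n lam X F"

lemma kernel_iff: "v \<in> K a \<longleftrightarrow> v \<in> F a \<and> (\<forall>l\<in>{1..n}. R a l v = lam l *s v)"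
  by (auto simp: reduced_kernel_def joint_kernel_def shifted_def)

lemma supplementary_step:
  assumes "a \<in> {1..s}"
  shows "subspace (F (Suc a))" "F a = {u + w | u w. u \<in> F (Suc a) \<and> w \<in> K a}"
    "F (Suc a) \<inter> K a = {0}"
proof -
  \<comment> \<open>\<open>reduction_spaces\<close> indexes each decomposition by the smaller space,
    hence the shift by one.\<close>
  have "Suc a \<in> {2..s+1}"
    using assms by auto
  then have "supplementary scale (F a) (F (Suc a)) (K a)"
    using spaces unfolding reduction_spaces_def by fastforce
  then show "subspace (F (Suc a))" "F a = {u + w | u w. u \<in> F (Suc a) \<and> w \<in> K a}"
    "F (Suc a) \<inter> K a = {0}"
    by (auto simp: supplementary_def)
qed

lemma subspace_F:
  assumes "a \<in> {1..s+1}"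
  shows "subspace (F a)"
proof (cases "a = 1")
  case True
  then show ?thesis
    using spaces subspace_UNIV by (simp add: reduction_spaces_def)
next
  case False
  then have "a - 1 \<in> {1..s}" "Suc (a - 1) = a"
    using assms by auto
  then show ?thesis
    using supplementary_step(1)[of "a - 1"] by simp
qed

lemma zero_in_kernel: "a \<in> {1..s} \<Longrightarrow> 0 \<in> K a"
  using supplementary_step(3) by blast

lemma F_Suc_subset:
  assumes "a \<in> {1..s}"
  shows "F (Suc a) \<subseteq> F a"
proof
  fix x assume "x \<in> F (Suc a)"
  then have "x + 0 \<in> F a"
    unfolding supplementary_step(2)[OF assms] using zero_in_kernel[OF assms] by blast
  then show "x \<in> F a"
    by simp
qed

lemma F_antimono:
  assumes "a \<le> b" "1 \<le> a" "b \<le> s + 1"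
  shows "F b \<subseteq> F a"
  using assms
proof (induction b rule: nat_induct_at_least)
  case (Suc b)
  then show ?case
    using F_Suc_subset[of b] by auto
qed simp

text \<open>The invariant carried through the reduction. The reduced operators are total functions
  that are meaningful only on \<open>F a\<close>, so both properties are relative to that
  space.\<close>

definition additive_on_F :: "nat \<Rightarrow> bool" where
  "additive_on_F a \<longleftrightarrow> (\<forall>l\<in>{1..n}. (\<forall>u\<in>F a. R a l u \<in> F a) \<and>
     (\<forall>u\<in>F a. \<forall>v\<in>F a. R a l (u + v) = R a l u + R a l v))"

lemma kernel_diff:
  assumes a: "a \<in> {1..s+1}" and add: "additive_on_F a" and "u \<in> K a" "v \<in> K a"
  shows "u - v \<in> K a"
proof -
  have uv: "u \<in> F a" "v \<in> F a" "u - v \<in> F a"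
    using assms(3,4) subspace_diff[OF subspace_F[OF a]] by (auto simp: kernel_iff)
  have "R a l (u - v) = lam l *s (u - v)" if l: "l \<in> {1..n}" for l
  proof -
    have "R a l ((u - v) + v) = R a l (u - v) + R a l v"
      using add l uv unfolding additive_on_F_def by blast
    then show ?thesis
      using assms(3,4) l by (simp add: kernel_iff scale_right_diff_distrib)
  qed
  then show ?thesis
    using uv kernel_iff by blast
qed

text \<open>Additivity makes \<open>K a\<close> closed under differences, so the projection is well
  defined and any decomposition identifies its value.\<close>

lemma reduced_op_unique:
  assumes a: "a \<in> {1..s}" and add: "additive_on_F a"
    and u: "u \<in> F (Suc a)" "R a l v - u \<in> K a"
  shows "R (Suc a) l v = u"
proof -
  have "R (Suc a) l v = projection_along (F (Suc a)) (K a) (R a l v)"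
    \<comment> \<open>The projecting equation of \<open>reduced_ops\<close> covers
      \<open>Suc a\<close> only from \<open>a = 1\<close> on.\<close>
    using a by (cases a) (auto simp: reduced_kernel_def)
  also have "\<dots> = u"
  proof (rule projection_along_props[OF _ _ supplementary_step(3)[OF a] u])
    show "x - y \<in> F (Suc a)" if "x \<in> F (Suc a)" "y \<in> F (Suc a)" for x y
      using supplementary_step(1)[OF a] that by (rule subspace_diff)
    show "x - y \<in> K a" if "x \<in> K a" "y \<in> K a" for x y
      using kernel_diff[OF _ add that] a by simp
  qed
  finally show ?thesis .
qed

lemma reduced_op_step:
  assumes a: "a \<in> {1..s}" and add: "additive_on_F a"
    and l: "l \<in> {1..n}" and v: "v \<in> F a"
  shows "R (Suc a) l v \<in> F (Suc a)" "R a l v - R (Suc a) l v \<in> K a"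
proof -
  have "R a l v \<in> F a"
    using add l v by (simp add: additive_on_F_def)
  then obtain u w where "R a l v = u + w" "u \<in> F (Suc a)" "w \<in> K a"
    using supplementary_step(2)[OF a] by auto
  moreover from this have "R (Suc a) l v = u"
    by (intro reduced_op_unique[OF a add]) auto
  ultimately show "R (Suc a) l v \<in> F (Suc a)" "R a l v - R (Suc a) l v \<in> K a"
    by auto
qed

lemma additive_on_F:
  assumes "1 \<le> a" "a \<le> s + 1"
  shows "additive_on_F a"
  using assms
proof (induction a rule: nat_induct_at_least)
  case base
  then show ?case
    using spaces additive_X by (auto simp: additive_on_F_def reduction_spaces_def)
next
  case (Suc a)
  then have a: "a \<in> {1..s}" and add: "additive_on_F a"
    by auto
  have a1: "Suc a \<in> {1..s+1}"
    using a by auto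
  note step = reduced_op_step[OF a add]
  have sub: "F (Suc a) \<subseteq> F a"
    by (rule F_Suc_subset[OF a])
  have "R (Suc a) l (u + v) = R (Suc a) l u + R (Suc a) l v"
    if l: "l \<in> {1..n}" and u: "u \<in> F (Suc a)" and v: "v \<in> F (Suc a)" for l u v
  proof (rule reduced_op_unique[OF a add])
    have uv: "u \<in> F a" "v \<in> F a"
      using u v sub by auto
    show "R (Suc a) l u + R (Suc a) l v \<in> F (Suc a)"
      using step(1) l uv subspace_add[OF subspace_F[OF a1]] by blast
    have 0: "0 \<in> K a"
      using zero_in_kernel a by simp
    have a': "a \<in> {1..s+1}"
      using a by auto
    \<comment> \<open>The sum of the two kernel components is written with differences, the only
      closure property of \<open>K a\<close> at hand.\<close>
    have "(R a l u - R (Suc a) l u) - (0 - (R a l v - R (Suc a) l v)) \<in> K a"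
      by (intro kernel_diff[OF a' add] step(2) l uv 0)
    moreover have "R a l (u + v) = R a l u + R a l v"
      using add l uv by (simp add: additive_on_F_def)
    ultimately show "R a l (u + v) - (R (Suc a) l u + R (Suc a) l v) \<in> K a"
      by (simp add: algebra_simps)
  qed
  then show ?case
    using step(1) sub by (auto simp: additive_on_F_def)
qed

text \<open>The part of \<open>G\<close> still to come at stage \<open>a\<close>: it is all of
  \<open>G\<close> for \<open>a = 1\<close> and the empty sum \<open>{0}\<close> for
  \<open>a = s + 1\<close>, which allows downward induction.\<close>

definition tail_sum :: "nat \<Rightarrow> 'e set" where
  "tail_sum a = {\<Sum>b=a..s. v b | v. \<forall>b\<in>{a..s}. v b \<in> K b}"

lemma tail_sum_step:
  assumes "a \<le> s"
  shows "tail_sum a = {w + g | w g. w \<in> K a \<and> g \<in> tail_sum (Suc a)}" (is "?L = ?R")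
proof
  show "?L \<subseteq> ?R"
  proof
    fix x assume "x \<in> ?L"
    then obtain v where v: "x = (\<Sum>b=a..s. v b)" "\<forall>b\<in>{a..s}. v b \<in> K b"
      unfolding tail_sum_def by auto
    have "x = v a + (\<Sum>b=Suc a..s. v b)"
      using v(1) assms by (simp add: sum.atLeast_Suc_atMost)
    moreover have "v a \<in> K a" "(\<Sum>b=Suc a..s. v b) \<in> tail_sum (Suc a)"
      using v(2) assms unfolding tail_sum_def by auto
    ultimately show "x \<in> ?R"
      by blast
  qed
  show "?R \<subseteq> ?L"
  proof
    fix x assume "x \<in> ?R"
    then obtain w v where v: "x = w + (\<Sum>b=Suc a..s. v b)" "w \<in> K a" "\<forall>b\<in>{Suc a..s}. v b \<in> K b"
      unfolding tail_sum_def by auto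
    have "(\<Sum>b=Suc a..s. (v(a := w)) b) = (\<Sum>b=Suc a..s. v b)"
      by (rule sum.cong) auto
    then have "x = (\<Sum>b=a..s. (v(a := w)) b)"
      using v(1) assms by (simp add: sum.atLeast_Suc_atMost)
    moreover have "\<forall>b\<in>{a..s}. (v(a := w)) b \<in> K b"
      using v(2,3) by auto
    ultimately show "x \<in> ?L"
      unfolding tail_sum_def by blast
  qed
qed

lemma tail_sum_subset:
  assumes "a \<in> {1..s+1}"
  shows "tail_sum a \<subseteq> F a"
proof
  fix x assume "x \<in> tail_sum a"
  then obtain v where v: "x = (\<Sum>b=a..s. v b)" "\<forall>b\<in>{a..s}. v b \<in> K b"
    unfolding tail_sum_def by auto
  have "v b \<in> F a" if "b \<in> {a..s}" for b
    using v(2) that assms F_antimono[of a b] by (auto simp: kernel_iff)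
  then show "x \<in> F a"
    unfolding v(1) by (rule subspace_sum[OF subspace_F[OF assms]])
qed

text \<open>Downward induction on \<open>a\<close>. Splitting \<open>v\<close> into \<open>u\<close>
  in \<open>F (Suc a)\<close> and \<open>w\<close> in \<open>K a\<close>, the shifted operators kill
  \<open>w\<close>; projecting along \<open>K a\<close> turns the hypothesis on \<open>v\<close>
  into the same hypothesis on \<open>u\<close> one stage later.\<close>

lemma tail_sum_closed:
  assumes "a \<le> s + 1" "1 \<le> a" "v \<in> F a"
    and "\<And>l. l \<in> {1..n} \<Longrightarrow> R a l v - lam l *s v \<in> tail_sum a"
  shows "v \<in> tail_sum a"
  using assms
proof (induction a arbitrary: v rule: inc_induct)
  case base
  have tail: "tail_sum (s + 1) = {0}"
    by (simp add: tail_sum_def)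
  \<comment> \<open>The stopping condition enters here: with tail \<open>{0}\<close> the hypothesis
    says that \<open>v\<close> is in the last kernel, which vanishes.\<close>
  have "v \<in> K (s + 1)"
    using base.prems unfolding tail by (simp add: kernel_iff)
  then show ?case
    using spaces tail by (simp add: reduction_spaces_def)
next
  case (step a)
  then have a: "a \<in> {1..s}" and a1: "Suc a \<in> {1..s+1}"
    by auto
  have add: "additive_on_F a"
    using additive_on_F a by auto
  obtain u w where uw: "v = u + w" "u \<in> F (Suc a)" "w \<in> K a"
    using step.prems(2) supplementary_step(2)[OF a] by auto
  have uF: "u \<in> F a" and wF: "w \<in> F a"
    using uw F_Suc_subset[OF a] kernel_iff by auto
  have "R (Suc a) l u - lam l *s u \<in> tail_sum (Suc a)" if l: "l \<in> {1..n}" for l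
  proof -
    obtain w' g where g: "R a l v - lam l *s v = w' + g" "w' \<in> K a" "g \<in> tail_sum (Suc a)"
      using step.prems(3)[OF l] tail_sum_step[of a] a by auto
    have "R a l v = R a l u + lam l *s w"
      using add l uF wF uw by (simp add: additive_on_F_def kernel_iff)
    then have eq: "R a l u - (g + lam l *s u) = w'"
      using g(1) uw(1) by (simp add: scale_right_distrib algebra_simps)
    \<comment> \<open>Since the next tail lies in \<open>F (Suc a)\<close>, this vector and
      \<open>w'\<close> are the two components of \<open>R a l u\<close>, and uniqueness yields the
      value of the next reduced operator.\<close>
    have "g + lam l *s u \<in> F (Suc a)"
      using g(3) tail_sum_subset[OF a1] uw(2)
      by (intro subspace_add subspace_scale subspace_F[OF a1]) auto
    then have "R (Suc a) l u = g + lam l *s u"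
      using reduced_op_unique[OF a add] eq g(2) by auto
    then show ?thesis
      using g(3) by simp
  qed
  then have "u \<in> tail_sum (Suc a)"
    using step.IH[of u] uw(2) by simp
  then show ?case
    using uw tail_sum_step[of a] a add.commute[of u w] by auto
qed

lemma sum_of_kernels_zero: "0 \<in> sum_of_subspaces s K"
  unfolding sum_of_subspaces_def using zero_in_kernel by (auto intro!: exI[of _ "\<lambda>_. 0"])

lemma sum_of_kernels_closed:
  assumes "\<And>l. l \<in> {1..n} \<Longrightarrow> shifted scale lam X l v \<in> sum_of_subspaces s K"
  shows "v \<in> sum_of_subspaces s K"
proof -
  have "sum_of_subspaces s K = tail_sum 1"
    by (simp add: sum_of_subspaces_def tail_sum_def)
  then show ?thesis
    using tail_sum_closed[of 1 v] assms spaces by (simp add: shifted_def reduction_spaces_def)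
qed

end

section \<open>Combining the homotopy with the reduction for the shifted operators\<close>

theorem corollary3:
  fixes scale :: "complex \<Rightarrow> 'e::ab_group_add \<Rightarrow> 'e"
    and Basis :: "'e set"
    and n s :: nat
    and lam :: "nat \<Rightarrow> complex"
    and X :: "nat \<Rightarrow> 'e \<Rightarrow> 'e"
    and F :: "nat \<Rightarrow> 'e set"
    and C :: "nat set \<Rightarrow> 'e"
  assumes "finite_dimensional_vector_space scale Basis"
    and "\<And>l. l \<in> {1..n} \<Longrightarrow> Vector_Spaces.linear scale scale (X l)"
    and "\<And>l m. l \<in> {1..n} \<Longrightarrow> m \<in> {1..n} \<Longrightarrow> X l \<circ> X m = X m \<circ> X l"
    and "reduction_spaces scale n lam X F s"
    and "koszul_cocycle scale n (shifted scale lam X) UNIV C"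
  shows "\<exists>C\<^sub>1. koszul_cocycle scale n (shifted scale lam X) UNIV C\<^sub>1
           \<and> koszul_cohomologous scale n (shifted scale lam X) UNIV C C\<^sub>1
           \<and> C\<^sub>1 \<in> tensor_grassmann n (sum_of_subspaces s (reduced_kernel scale n lam X F))"
proof -
  interpret finite_dimensional_vector_space scale Basis
    by (rule assms(1))
  note linX = linear_op_simps[OF assms(2)]
  have comm: "X k (X l v) = X l (X k v)" if "k \<in> {1..n}" "l \<in> {1..n}" for k l v
    using assms(3)[OF that] by (metis comp_apply)
  interpret commuting_operators scale n "shifted scale lam X"
  proof (intro commuting_operators.intro commuting_operators_axioms.intro vector_space_axioms)
    show "Vector_Spaces.linear scale scale (shifted scale lam X k)" if "k \<in> {1..n}" for k
      unfolding shifted_def by (intro linear_diff_op assms(2) that linear_scale_self)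
    show "shifted scale lam X k (shifted scale lam X l v) = shifted scale lam X l (shifted scale lam X k v)"
      if "k \<in> {1..n}" "l \<in> {1..n}" for k l v
      using that comm
      by (simp add: shifted_def linX scale_right_diff_distrib algebra_simps)
  qed
  interpret finite_dimensional_commuting_operators scale n "shifted scale lam X" Basis ..
  interpret reduction scale n s lam X F
    by unfold_locales (simp_all add: linX assms(4))
  show ?thesis
    using cocycle_cohomologous_in[OF sum_of_kernels_zero sum_of_kernels_closed assms(5)] .
qed

end
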